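(* Let $\mathcal{H}$ be a complex Hilbert space and let $A\in\mathcal{B}(\mathcal{H})$ be a bounded linear operator on $\mathcal{H}$. Then $$\frac{1}{4}\left\| |A|^2+|A^*|^2 \right\|\le \frac{1}{2}\sqrt{2\,\omega^4(A)+\frac{1}{8}\,\omega\left( (A^*-A)^2(A^*+A)^2 \right)}\le \omega^2(A).$$
   Context: $\mathcal{B}(\mathcal{H})$ is the $C^*$-algebra of all bounded linear operators on the complex Hilbert space $\mathcal{H}$ with inner product $\langle\cdot,\cdot\rangle$; $\|\cdot\|$ is the operator norm; $|T|=(T^*T)^{1/2}$, so $|A|^2=A^*A$ and $|A^*|^2=AA^*$. The numerical radius is $\omega(T)=\sup_{\|x\|=1}|\langle Tx,x\rangle|$, and $\omega^k(A)=(\omega(A))^k$. *)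

theory Defs
  imports "HOL-Analysis.Analysis"
begin

text \<open>
  Complex inner product spaces, as an extension of the class of real ones: the underlying real
  inner product is the real part of the complex one, so the norm is the usual one, and
  positive definiteness is inherited from \<^class>\<open>real_inner\<close>. The complex inner product is linear
  in the first argument.
\<close>

class complex_inner = real_inner +
  fixes scaleC :: "complex \<Rightarrow> 'a \<Rightarrow> 'a"  (infixr "*\<^sub>C" 75)
    and cinner :: "'a \<Rightarrow> 'a \<Rightarrow> complex"
  assumes scaleC_add_right: "c *\<^sub>C (x + y) = c *\<^sub>C x + c *\<^sub>C y"
    and scaleC_add_left: "(c + d) *\<^sub>C x = c *\<^sub>C x + d *\<^sub>C x"
    and scaleC_scaleC: "c *\<^sub>C d *\<^sub>C x = (c * d) *\<^sub>C x"
    and scaleC_of_real: "complex_of_real r *\<^sub>C x = scaleR r x"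
    and cinner_commute: "cinner x y = cnj (cinner y x)"
    and cinner_add_left: "cinner (x + y) z = cinner x z + cinner y z"
    and cinner_scaleC_left: "cinner (c *\<^sub>C x) y = c * cinner x y"
    and Re_cinner: "Re (cinner x y) = inner x y"

class chilbert_space = complex_inner + complete_space

lemma scaleC_one: "1 *\<^sub>C x = (x :: 'a::complex_inner)"
  using scaleC_of_real[of 1 x] by simp

lemma cinner_self: "cinner x x = complex_of_real ((norm (x :: 'a::complex_inner))\<^sup>2)"
proof -
  have "Im (cinner x x) = Im (cnj (cinner x x))"
    using cinner_commute[of x x] by simp
  then show ?thesis
    by (simp add: complex_eq_iff Re_cinner power2_norm_eq_inner)
qed

instantiation complex :: chilbert_space
begin

definition "scaleC_complex (c :: complex) (x :: complex) = c * x"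
definition "cinner_complex (x :: complex) (y :: complex) = x * cnj y"

instance
  by standard
    (auto simp: scaleC_complex_def cinner_complex_def inner_complex_def scaleR_conv_of_real
      algebra_simps)

end

definition bounded_clinear :: "('a::complex_inner \<Rightarrow> 'b::complex_inner) \<Rightarrow> bool" where
  "bounded_clinear T \<longleftrightarrow> bounded_linear T \<and> (\<forall>c x. T (c *\<^sub>C x) = c *\<^sub>C T x)"

definition cadjoint :: "('a::complex_inner \<Rightarrow> 'b::complex_inner) \<Rightarrow> 'b \<Rightarrow> 'a" where
  "cadjoint T = (THE S. \<forall>x y. cinner (T x) y = cinner x (S y))"

definition positive_op :: "('a::complex_inner \<Rightarrow> 'a) \<Rightarrow> bool" where
  "positive_op P \<longleftrightarrow> bounded_clinear P \<and> (\<forall>x. cinner (P x) x \<in> \<real>\<^sub>\<ge>\<^sub>0)"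

text \<open>
  A positive operator on a Hilbert space has exactly one positive square root, so the choice
  operator picks \<open>(T\<^sup>* T)\<^sup>1\<^sup>/\<^sup>2\<close> below. Powers of operators are iterates.
\<close>

definition sqrt_op :: "('a::complex_inner \<Rightarrow> 'a) \<Rightarrow> 'a \<Rightarrow> 'a" where
  "sqrt_op T = (SOME P. positive_op P \<and> P ^^ 2 = T)"

definition abs_op :: "('a::complex_inner \<Rightarrow> 'a) \<Rightarrow> 'a \<Rightarrow> 'a" where
  "abs_op T = sqrt_op (cadjoint T \<circ> T)"

text \<open>
  The element \<open>0\<close> matters only for the zero space, which has no unit vectors: the supremum
  is taken in the nonnegative reals, where the supremum of the empty set is \<open>0\<close>.
\<close>

definition numerical_radius :: "('a::complex_inner \<Rightarrow> 'a) \<Rightarrow> real" where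
  "numerical_radius T = Sup (insert 0 {cmod (cinner (T x) x) | x. norm x = 1})"

end

theory Submission imports Defs begin

text \<open>
  Put \<open>M = A\<^sup>* + A\<close>, \<open>N = A\<^sup>* - A\<close> and \<open>w = \<omega>(A)\<close>. Up to the factors \<open>2\<close> and \<open>- 2\<i>\<close> these are the
  real and the imaginary part of \<open>A\<close>. The sum \<open>P = |A|\<^sup>2 + |A\<^sup>*|\<^sup>2 = A\<^sup>* A + A A\<^sup>*\<close> satisfies
  \<open>2 P = M\<^sup>2 - N\<^sup>2\<close>, since the squares \<open>A\<^sup>2\<close> and \<open>A\<^sup>*\<^sup>2\<close> cancel. As \<open>N\<^sup>2\<close> is self-adjoint, expanding
  the square gives
  \<open>4 \<parallel>P x\<parallel>\<^sup>2 = \<parallel>M\<^sup>2 x\<parallel>\<^sup>2 + \<parallel>N\<^sup>2 x\<parallel>\<^sup>2 - 2 Re \<langle>N\<^sup>2 M\<^sup>2 x, x\<rangle>\<close>.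
  The last term is at most \<open>2 \<omega>(N\<^sup>2 M\<^sup>2) \<parallel>x\<parallel>\<^sup>2\<close>. The operators \<open>M\<close> and \<open>\<i> N\<close> are self-adjoint with
  quadratic forms \<open>2 Re \<langle>A x, x\<rangle>\<close> and \<open>2 Im \<langle>A x, x\<rangle>\<close>, both bounded by \<open>2 w \<parallel>x\<parallel>\<^sup>2\<close>. Because the norm
  of a self-adjoint operator is controlled by its quadratic form
  (\<open>norm_le_quadratic_form_bound\<close>), \<open>\<parallel>M\<parallel>\<close> and \<open>\<parallel>N\<parallel>\<close> are at most \<open>2 w\<close>, so the first two terms are
  at most \<open>16 w\<^sup>4 \<parallel>x\<parallel>\<^sup>2\<close> each. This is the first inequality. The same norm bounds give
  \<open>\<omega>(N\<^sup>2 M\<^sup>2) \<le> \<parallel>N\<parallel>\<^sup>2 \<parallel>M\<parallel>\<^sup>2 \<le> 16 w\<^sup>4\<close>, which is the second.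

  The adjoint and the square root enter through descriptions, so their existence has to be
  established before \<open>|A|\<^sup>2\<close> can be replaced by \<open>A\<^sup>* A\<close>. The adjoint comes from the Riesz
  representation theorem (\<open>riesz_representation\<close>). The square root of a positive contraction \<open>T\<close>
  is \<open>1 - Y\<close>, where \<open>Y\<close> is a fixed point of \<open>Y \<mapsto> (X + Y\<^sup>2) / 2\<close> for \<open>X = 1 - T\<close>; the fixed point
  is a limit of iterates (\<open>contraction_square_root\<close>), and \<open>A\<^sup>* A\<close> becomes a contraction after
  scaling (\<open>abs_op_square\<close>).
\<close>

section \<open>Complex and real inner products\<close>

lemma Im_cinner: "Im (cinner x y) = - inner (\<i> *\<^sub>C x) (y :: 'a::complex_inner)"
  by (simp add: Re_cinner[symmetric] cinner_scaleC_left)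

lemma cinner_eqI:
  assumes "inner x y = inner u v" "inner (\<i> *\<^sub>C x) y = inner (\<i> *\<^sub>C u) v"
  shows "cinner x (y :: 'a::complex_inner) = cinner u (v :: 'b::complex_inner)"
  using assms by (simp add: complex_eq_iff Re_cinner Im_cinner)

lemma cinner_diff_left: "cinner (x - y) z = cinner x z - cinner y (z :: 'a::complex_inner)"
  using cinner_add_left[of "x - y" y z] by simp

lemma scaleC_minus_left: "(- c) *\<^sub>C x = - (c *\<^sub>C (x :: 'a::complex_inner))"
  using scaleC_add_left[of "- c" c x] scaleC_of_real[of 0 x] by (simp add: eq_neg_iff_add_eq_0)

lemma scaleC_scaleR: "c *\<^sub>C (r *\<^sub>R x) = r *\<^sub>R (c *\<^sub>C (x :: 'a::complex_inner))"
  by (simp add: scaleC_of_real[symmetric] scaleC_scaleC mult.commute)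

lemma inner_scaleC_left: "inner (c *\<^sub>C x) y = inner x (cnj c *\<^sub>C (y :: 'a::complex_inner))"
proof -
  have "cinner (c *\<^sub>C x) y = cinner x (cnj c *\<^sub>C y)"
    using cinner_commute[of x "cnj c *\<^sub>C y"] cinner_commute[of x y]
    by (simp add: cinner_scaleC_left)
  then show ?thesis by (simp add: Re_cinner[symmetric])
qed

lemma norm_scaleC: "norm (c *\<^sub>C x) = cmod c * norm (x :: 'a::complex_inner)"
proof -
  have "(norm (c *\<^sub>C x))\<^sup>2 = inner x ((cnj c * c) *\<^sub>C x)"
    by (simp add: power2_norm_eq_inner inner_scaleC_left scaleC_scaleC)
  also have "cnj c * c = complex_of_real ((cmod c)\<^sup>2)"
    by (metis complex_norm_square mult.commute)
  finally have "(norm (c *\<^sub>C x))\<^sup>2 = (cmod c * norm x)\<^sup>2"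
    by (simp only: scaleC_of_real inner_scaleR_right power_mult_distrib power2_norm_eq_inner)
  then show ?thesis by (simp add: power2_eq_iff_nonneg)
qed

lemma bounded_linear_scaleC: "bounded_linear (\<lambda>x. c *\<^sub>C (x :: 'a::complex_inner))"
  by (rule bounded_linear_intro[where K = "cmod c"])
     (simp_all add: scaleC_add_right scaleC_scaleR norm_scaleC mult.commute)

lemma cmod_cinner_le: "cmod (cinner x y) \<le> norm x * norm (y :: 'a::complex_inner)"
proof (cases "cinner x y = 0")
  case False
  \<comment> \<open>A phase turns the complex inner product into a nonnegative real one.\<close>
  define c where "c = cnj (cinner x y) / cmod (cinner x y)"
  have "cmod c = 1" using False by (simp add: c_def norm_divide)
  have "cinner (c *\<^sub>C x) y = cmod (cinner x y)"
    using False
    by (simp add: cinner_scaleC_left c_def complex_norm_square[symmetric] power2_eq_square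
        mult.commute[of "cnj _"] divide_eq_eq flip: of_real_mult)
  then have "cmod (cinner x y) = inner (c *\<^sub>C x) y"
    by (metis Re_cinner Re_complex_of_real)
  also have "\<dots> \<le> norm (c *\<^sub>C x) * norm y" by (rule norm_cauchy_schwarz)
  finally show ?thesis using \<open>cmod c = 1\<close> by (simp add: norm_scaleC)
qed simp

instance chilbert_space \<subseteq> banach ..

lemma bounded_clinear_imp_bounded_linear: "bounded_clinear T \<Longrightarrow> bounded_linear T"
  by (simp add: bounded_clinear_def)

lemma bounded_clinear_scaleC: "bounded_clinear T \<Longrightarrow> T (c *\<^sub>C x) = c *\<^sub>C T x"
  by (simp add: bounded_clinear_def)

lemma bounded_clinear_add:
  "bounded_clinear S \<Longrightarrow> bounded_clinear T \<Longrightarrow> bounded_clinear (\<lambda>x. S x + T x)"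
  by (simp add: bounded_clinear_def bounded_linear_add scaleC_add_right)

lemma bounded_clinear_diff:
  "bounded_clinear S \<Longrightarrow> bounded_clinear T \<Longrightarrow> bounded_clinear (\<lambda>x. S x - T x)"
  by (simp add: bounded_clinear_def bounded_linear_sub
      linear_diff[OF bounded_linear.linear[OF bounded_linear_scaleC]])

lemma bounded_clinear_scaleR:
  "bounded_clinear T \<Longrightarrow> bounded_clinear (\<lambda>x. r *\<^sub>R T x)"
  by (simp add: bounded_clinear_def bounded_linear_const_scaleR scaleC_scaleR)

lemma bounded_clinear_compose:
  "bounded_clinear S \<Longrightarrow> bounded_clinear T \<Longrightarrow> bounded_clinear (S \<circ> T)"
  by (auto simp: bounded_clinear_def comp_def intro: bounded_linear_compose)

section \<open>The adjoint\<close>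

text \<open>
  The representing vector minimises \<open>J x = \<parallel>x\<parallel>\<^sup>2 - 2 f x = \<parallel>x - z\<parallel>\<^sup>2 - \<parallel>z\<parallel>\<^sup>2\<close>. By the parallelogram law
  every minimising sequence of \<open>J\<close> is Cauchy, so completeness provides a minimiser, and the
  vanishing of the derivative of \<open>J\<close> there is the representation of \<open>f\<close>.
\<close>

lemma riesz_representation:
  fixes f :: "'a::{real_inner, complete_space} \<Rightarrow> real"
  assumes "bounded_linear f"
  shows "\<exists>z. \<forall>x. f x = inner x z"
proof -
  interpret f: bounded_linear f by fact
  obtain K where K: "\<And>x. norm (f x) \<le> norm x * K"
    using f.bounded by blast
  define J where "J x = (norm x)\<^sup>2 - 2 * f x" for x
  have below: "- K\<^sup>2 \<le> J x" for x
  proof -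
    have "0 \<le> (norm x - K)\<^sup>2" by simp
    moreover have "f x \<le> norm x * K" using K[of x] by simp
    ultimately show ?thesis by (simp add: J_def power2_diff)
  qed
  define d where "d = Inf (range J)"
  have bdd: "bdd_below (range J)" using below by (intro bdd_belowI[where m = "- K\<^sup>2"]) auto
  have d_le: "d \<le> J x" for x unfolding d_def by (rule cInf_lower[OF _ bdd]) simp
  have "\<exists>x. J x < d + inverse (real (Suc n))" for n
  proof -
    have "Inf (range J) < d + inverse (real (Suc n))" by (simp add: d_def)
    then show ?thesis using cInf_lessD[of "range J"] by blast
  qed
  then obtain u where u: "\<And>n. J (u n) < d + inverse (real (Suc n))" by metis
  have close: "(norm (x - y))\<^sup>2 \<le> 2 * ((J x - d) + (J y - d))" for x y
  proof -
    have "J x + J y = 2 * J ((1/2) *\<^sub>R (x + y)) + (norm (x - y))\<^sup>2 / 2"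
      by (simp add: J_def power2_norm_eq_inner f.scaleR f.add inner_add_left inner_add_right
          inner_diff_left inner_diff_right inner_commute[of y x] field_simps)
    then show ?thesis using d_le[of "(1/2) *\<^sub>R (x + y)"] by simp
  qed
  have "Cauchy u"
  proof (rule metric_CauchyI)
    fix e :: real assume "0 < e"
    obtain N where N: "inverse (real (Suc N)) < e\<^sup>2 / 4"
      using reals_Archimedean[of "e\<^sup>2 / 4"] \<open>0 < e\<close> by auto
    have "dist (u m) (u n) < e" if "m \<ge> N" "n \<ge> N" for m n
    proof -
      have "J (u k) - d < e\<^sup>2 / 4" if "k \<ge> N" for k
      proof -
        have "inverse (real (Suc k)) \<le> inverse (real (Suc N))"
          using that by (intro le_imp_inverse_le) simp_all
        then show ?thesis using u[of k] N by linarith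
      qed
      from this[OF that(1)] this[OF that(2)]
      have "(norm (u m - u n))\<^sup>2 < e\<^sup>2"
        using close[of "u m" "u n"] by argo
      then show ?thesis using \<open>0 < e\<close> by (simp add: dist_norm power2_less_imp_less)
    qed
    then show "\<exists>N. \<forall>m\<ge>N. \<forall>n\<ge>N. dist (u m) (u n) < e" by blast
  qed
  then obtain z where z: "u \<longlonglongrightarrow> z" using Cauchy_convergent convergent_def by blast
  have "(\<lambda>n. J (u n)) \<longlonglongrightarrow> J z"
    unfolding J_def by (intro tendsto_intros z f.tendsto)
  moreover have "(\<lambda>n. d + inverse (real (Suc n))) \<longlonglongrightarrow> d + 0"
    by (intro tendsto_intros LIMSEQ_inverse_real_of_nat)
  ultimately have "J z \<le> d + 0"
    by (rule LIMSEQ_le) (use u in \<open>auto intro: less_imp_le\<close>)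
  then have minimal: "J z \<le> J x" for x using d_le[of x] by simp
  have "f x = inner x z" for x
  proof (cases "x = 0")
    case False
    define g where "g = inner x z - f x"
    define s where "s = (norm x)\<^sup>2"
    have "s > 0" using False by (simp add: s_def)
    have "(norm (z + t *\<^sub>R x))\<^sup>2 = (norm z)\<^sup>2 + t\<^sup>2 * s + 2 * t * inner x z" for t
      unfolding s_def power2_norm_eq_inner
      by (simp add: inner_add_left inner_add_right inner_commute[of z x] power2_eq_square
          distrib_left)
    then have shift: "J (z + t *\<^sub>R x) = J z + t\<^sup>2 * s + 2 * t * g" for t
      by (simp add: J_def g_def f.scaleR f.add algebra_simps)
    \<comment> \<open>The parabola in \<open>t\<close> is minimal at \<open>- g / s\<close>, with value \<open>- g\<^sup>2 / s\<close> relative to \<open>t = 0\<close>.\<close>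
    have "0 \<le> (- g / s)\<^sup>2 * s + 2 * (- g / s) * g"
      using minimal[of "z + (- g / s) *\<^sub>R x"] unfolding shift by linarith
    then have "0 \<le> - (g\<^sup>2 / s)"
      using \<open>s > 0\<close> by (simp add: power2_eq_square)
    then have "g\<^sup>2 / s \<le> 0" by linarith
    then have "g = 0" using \<open>s > 0\<close> by (simp add: divide_le_0_iff)
    then show ?thesis by (simp add: g_def)
  qed (simp add: f.zero)
  then show ?thesis by blast
qed

lemma cadjoint_eqI:
  fixes T :: "'a::complex_inner \<Rightarrow> 'b::complex_inner"
  assumes "\<And>x y. cinner (T x) y = cinner x (S y)"
  shows "cadjoint T = S"
  unfolding cadjoint_def
proof (rule the_equality)
  fix S' assume S': "\<forall>x y. cinner (T x) y = cinner x (S' y)"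
  show "S' = S"
  proof
    fix y
    have "inner x (S' y) = inner x (S y)" for x
      using S' assms by (metis Re_cinner)
    then have "inner (S' y - S y) (S' y - S y) = 0" by (simp add: inner_diff_right)
    then show "S' y = S y" by simp
  qed
qed (use assms in blast)

text \<open>
  The real Riesz theorem represents \<open>x \<mapsto> Re \<langle>T x, y\<rangle>\<close>, and replacing \<open>x\<close> by \<open>\<i> x\<close> recovers the imaginary part because \<open>T\<close> is complex linear.
\<close>

lemma cinner_cadjoint:
  fixes T :: "'a::chilbert_space \<Rightarrow> 'b::complex_inner"
  assumes "bounded_clinear T"
  shows "cinner (T x) y = cinner x (cadjoint T y)"
proof -
  have "\<exists>z. \<forall>x. inner (T x) y = inner x z" for y
    using assms
    by (intro riesz_representation bounded_linear_compose[OF bounded_linear_inner_left])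
       (rule bounded_clinear_imp_bounded_linear)
  then obtain S where S: "\<And>x y. inner (T x) y = inner x (S y)" by metis
  have "cinner (T x) y = cinner x (S y)" for x y
    by (rule cinner_eqI)
       (simp_all add: S flip: bounded_clinear_scaleC[OF assms])
  then show ?thesis using cadjoint_eqI by metis
qed

lemma inner_cadjoint:
  fixes T :: "'a::chilbert_space \<Rightarrow> 'b::complex_inner"
  assumes "bounded_clinear T"
  shows "inner (T x) y = inner x (cadjoint T y)"
  using cinner_cadjoint[OF assms] by (metis Re_cinner)

lemma inner_eqI: "(\<And>x. inner x u = inner x v) \<Longrightarrow> u = (v :: 'a::real_inner)"
  by (metis inner_diff_right inner_eq_zero_iff right_minus_eq)

lemma norm_cadjoint_le:
  fixes T :: "'a::chilbert_space \<Rightarrow> 'b::complex_inner"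
  assumes "bounded_clinear T" and "0 \<le> K" and K: "\<And>x. norm (T x) \<le> K * norm x"
  shows "norm (cadjoint T y) \<le> K * norm y"
proof (cases "cadjoint T y = 0")
  case True
  then show ?thesis using \<open>0 \<le> K\<close> by simp
next
  case False
  have "(norm (cadjoint T y))\<^sup>2 = inner (T (cadjoint T y)) y"
    by (simp add: power2_norm_eq_inner inner_cadjoint[OF assms(1)])
  also have "\<dots> \<le> norm (T (cadjoint T y)) * norm y" by (rule norm_cauchy_schwarz)
  also have "\<dots> \<le> (K * norm (cadjoint T y)) * norm y" by (intro mult_right_mono K) simp
  finally show ?thesis using False by (simp add: power2_eq_square mult_ac)
qed

lemma bounded_clinear_cadjoint:
  fixes T :: "'a::chilbert_space \<Rightarrow> 'b::complex_inner"
  assumes "bounded_clinear T"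
  shows "bounded_clinear (cadjoint T)"
proof -
  note adj = inner_cadjoint[OF assms, symmetric]
  obtain K where K: "0 < K" "\<And>x. norm (T x) \<le> norm x * K"
    using bounded_linear.pos_bounded[OF bounded_clinear_imp_bounded_linear[OF assms]] by blast
  have "cadjoint T (x + y) = cadjoint T x + cadjoint T y" for x y
    by (rule inner_eqI) (simp add: adj inner_add_right)
  moreover have "cadjoint T (r *\<^sub>R x) = r *\<^sub>R cadjoint T x" for r x
    by (rule inner_eqI) (simp add: adj)
  moreover have "cadjoint T (c *\<^sub>C x) = c *\<^sub>C cadjoint T x" for c x
  proof (rule inner_eqI)
    fix u
    have "inner u (cadjoint T (c *\<^sub>C x)) = inner (T (cnj c *\<^sub>C u)) x"
      by (simp add: adj bounded_clinear_scaleC[OF assms] inner_scaleC_left)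
    also have "\<dots> = inner u (c *\<^sub>C cadjoint T x)"
      by (simp add: inner_cadjoint[OF assms] inner_scaleC_left)
    finally show "inner u (cadjoint T (c *\<^sub>C x)) = inner u (c *\<^sub>C cadjoint T x)" .
  qed
  moreover have "norm (cadjoint T x) \<le> norm x * K" for x
    using norm_cadjoint_le[OF assms, of K x] K by (simp add: mult.commute)
  ultimately show ?thesis
    unfolding bounded_clinear_def by (blast intro: bounded_linear_intro)
qed

lemma cadjoint_cadjoint:
  fixes T :: "'a::chilbert_space \<Rightarrow> 'b::chilbert_space"
  assumes "bounded_clinear T"
  shows "cadjoint (cadjoint T) = T"
proof (rule cadjoint_eqI)
  fix x y
  show "cinner (cadjoint T x) y = cinner x (T y)"
    using cinner_cadjoint[OF assms, of y x] cinner_commute by metis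
qed

section \<open>Square roots of positive operators\<close>

text \<open>
  If \<open>Y\<close> is a limit of these iterates, then \<open>2 Y = X + Y\<^sup>2\<close>, that is \<open>(1 - Y)\<^sup>2 = 1 - X\<close>.
\<close>

primrec sqrt_iter :: "('a::real_normed_vector \<Rightarrow>\<^sub>L 'a) \<Rightarrow> nat \<Rightarrow> 'a \<Rightarrow>\<^sub>L 'a" where
  "sqrt_iter X 0 = 0"
| "sqrt_iter X (Suc n) = (1/2) *\<^sub>R (X + (sqrt_iter X n o\<^sub>L sqrt_iter X n))"

text \<open>
  The same iteration with the scalar \<open>1\<close> in place of \<open>X\<close>. The iterates and their successive
  differences are polynomials in \<open>X\<close> with nonnegative coefficients, so for \<open>\<parallel>X\<parallel> \<le> 1\<close> their norms are
  at most the corresponding scalars. Convergence of the scalar iteration thus yields convergence of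
  the operator iteration even for \<open>\<parallel>X\<parallel> = 1\<close>, where the map \<open>Y \<mapsto> (X + Y\<^sup>2) / 2\<close> need not be a strict
  contraction of the unit ball.
\<close>

primrec sqrt_iter_bound :: "nat \<Rightarrow> real" where
  "sqrt_iter_bound 0 = 0"
| "sqrt_iter_bound (Suc n) = (1 + (sqrt_iter_bound n)\<^sup>2) / 2"

lemma sqrt_iter_bound_range: "0 \<le> sqrt_iter_bound n \<and> sqrt_iter_bound n \<le> 1"
  by (induction n) (auto simp: power_le_one)

lemma incseq_sqrt_iter_bound: "incseq sqrt_iter_bound"
proof (rule incseq_SucI)
  fix n
  have "0 \<le> (1 - sqrt_iter_bound n)\<^sup>2" by simp
  then show "sqrt_iter_bound n \<le> sqrt_iter_bound (Suc n)" by (simp add: power2_diff)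
qed

text \<open>
  Used twice: with \<open>Z\<close> an iterate, so that iterates commute with each other, and with \<open>Z\<close> a
  multiplication by a complex scalar, so that iterates are complex linear.
\<close>

lemma sqrt_iter_commute:
  assumes "Z o\<^sub>L X = X o\<^sub>L Z"
  shows "Z o\<^sub>L sqrt_iter X n = sqrt_iter X n o\<^sub>L Z"
proof (induction n)
  case (Suc n)
  let ?Y = "sqrt_iter X n"
  have "Z o\<^sub>L (?Y o\<^sub>L ?Y) = (?Y o\<^sub>L ?Y) o\<^sub>L Z"
    using Suc[THEN arg_cong, of blinfun_apply, THEN fun_cong] by (intro blinfun_eqI) simp
  then show ?case
    using assms
    by (simp add: bounded_bilinear.scaleR_left[OF bounded_bilinear_blinfun_compose]
        bounded_bilinear.scaleR_right[OF bounded_bilinear_blinfun_compose]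
        bounded_bilinear.add_left[OF bounded_bilinear_blinfun_compose]
        bounded_bilinear.add_right[OF bounded_bilinear_blinfun_compose])
qed (simp add: bounded_bilinear.zero_left[OF bounded_bilinear_blinfun_compose]
        bounded_bilinear.zero_right[OF bounded_bilinear_blinfun_compose])

lemma norm_sqrt_iter_le:
  assumes "norm X \<le> 1"
  shows "norm (sqrt_iter X n) \<le> sqrt_iter_bound n"
proof (induction n)
  case (Suc n)
  let ?Y = "sqrt_iter X n"
  have "norm (?Y o\<^sub>L ?Y) \<le> (sqrt_iter_bound n)\<^sup>2"
    using norm_blinfun_compose[of ?Y ?Y] mult_mono[OF Suc Suc] sqrt_iter_bound_range[of n]
    by (simp add: power2_eq_square)
  then show ?case
    using norm_triangle_ineq[of X "?Y o\<^sub>L ?Y"] assms by simp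
qed simp

text \<open>
  Commuting iterates satisfy \<open>Y'\<^sup>2 - Y\<^sup>2 = (Y' - Y) (Y' + Y)\<close>, so each step of the operator iteration
  is estimated by the corresponding identity for the scalar iteration.
\<close>

lemma norm_sqrt_iter_step_le:
  assumes "norm X \<le> 1"
  shows "norm (sqrt_iter X (Suc n) - sqrt_iter X n) \<le> sqrt_iter_bound (Suc n) - sqrt_iter_bound n"
proof (induction n)
  case 0
  show ?case using assms by simp
next
  case (Suc n)
  let ?Y = "sqrt_iter X n" and ?Y' = "sqrt_iter X (Suc n)"
  let ?y = "sqrt_iter_bound n" and ?y' = "sqrt_iter_bound (Suc n)"
  have comm: "?Y o\<^sub>L ?Y' = ?Y' o\<^sub>L ?Y"
    by (intro sqrt_iter_commute sqrt_iter_commute[symmetric] refl)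
  have "sqrt_iter X (Suc (Suc n)) - ?Y' = (1/2) *\<^sub>R ((?Y' o\<^sub>L ?Y') - (?Y o\<^sub>L ?Y))"
    by (simp only: sqrt_iter.simps(2)[of X "Suc n"] sqrt_iter.simps(2)[of X n])
       (simp add: scaleR_diff_right[symmetric])
  also have "(?Y' o\<^sub>L ?Y') - (?Y o\<^sub>L ?Y) = (?Y' - ?Y) o\<^sub>L (?Y' + ?Y)"
    using comm
    by (simp only: bounded_bilinear.diff_left[OF bounded_bilinear_blinfun_compose]
        bounded_bilinear.add_right[OF bounded_bilinear_blinfun_compose]) simp
  finally have "norm (sqrt_iter X (Suc (Suc n)) - ?Y') = norm ((?Y' - ?Y) o\<^sub>L (?Y' + ?Y)) / 2"
    by (simp del: sqrt_iter.simps)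
  also have "\<dots> \<le> norm (?Y' - ?Y) * norm (?Y' + ?Y) / 2"
    using norm_blinfun_compose by (intro divide_right_mono) auto
  also have "\<dots> \<le> (?y' - ?y) * (?y' + ?y) / 2"
    using Suc norm_triangle_ineq[of ?Y' ?Y] norm_sqrt_iter_le[OF assms, of n]
      norm_sqrt_iter_le[OF assms, of "Suc n"] incseq_SucD[OF incseq_sqrt_iter_bound, of n]
    by (intro divide_right_mono mult_mono) (auto simp del: sqrt_iter.simps sqrt_iter_bound.simps)
  also have "\<dots> = sqrt_iter_bound (Suc (Suc n)) - ?y'"
    by (simp only: sqrt_iter_bound.simps(2)[of "Suc n"] sqrt_iter_bound.simps(2)[of n])
       (simp add: field_simps power2_eq_square)
  finally show ?case .
qed

lemma norm_sqrt_iter_diff_le: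
  assumes "norm X \<le> 1" "n \<le> m"
  shows "norm (sqrt_iter X m - sqrt_iter X n) \<le> sqrt_iter_bound m - sqrt_iter_bound n"
  using assms(2)
proof (induction m rule: dec_induct)
  case (step m)
  have "norm (sqrt_iter X (Suc m) - sqrt_iter X n)
      \<le> norm (sqrt_iter X (Suc m) - sqrt_iter X m) + norm (sqrt_iter X m - sqrt_iter X n)"
    using norm_triangle_ineq[of "sqrt_iter X (Suc m) - sqrt_iter X m" "sqrt_iter X m - sqrt_iter X n"]
    by (simp del: sqrt_iter.simps)
  then show ?case
    using step.IH norm_sqrt_iter_step_le[OF assms(1), of m] by linarith
qed simp

lemma convergent_sqrt_iter:
  fixes X :: "'a::banach \<Rightarrow>\<^sub>L 'a"
  assumes "norm X \<le> 1"
  shows "convergent (sqrt_iter X)"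
proof -
  obtain L where "sqrt_iter_bound \<longlonglongrightarrow> L"
    using incseq_convergent[OF incseq_sqrt_iter_bound, of 1] sqrt_iter_bound_range by blast
  then have Cauchy_bound: "Cauchy sqrt_iter_bound" by (rule LIMSEQ_imp_Cauchy)
  have "Cauchy (sqrt_iter X)"
  proof (rule metric_CauchyI)
    fix e :: real assume "0 < e"
    then obtain N where N: "\<And>m n. m \<ge> N \<Longrightarrow> n \<ge> N \<Longrightarrow> dist (sqrt_iter_bound m) (sqrt_iter_bound n) < e"
      using metric_CauchyD[OF Cauchy_bound] by metis
    have "norm (sqrt_iter X m - sqrt_iter X n) < e" if "N \<le> n" "n \<le> m" for m n
      using norm_sqrt_iter_diff_le[OF assms that(2)] N[of m n] that
      by (simp add: dist_real_def)
    then have "dist (sqrt_iter X m) (sqrt_iter X n) < e" if "N \<le> n" "N \<le> m" for m n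
      using that by (metis dist_norm norm_minus_commute nle_le)
    then show "\<exists>N. \<forall>m\<ge>N. \<forall>n\<ge>N. dist (sqrt_iter X m) (sqrt_iter X n) < e" by blast
  qed
  then show ?thesis by (rule Cauchy_convergent)
qed

lemma symmetric_imp_cinner_real:
  fixes P :: "'a::complex_inner \<Rightarrow> 'a"
  assumes lin: "\<And>c x. P (c *\<^sub>C x) = c *\<^sub>C P x" and sym: "\<And>x y. inner (P x) y = inner x (P y)"
  shows "cinner (P x) x = complex_of_real (inner (P x) x)"
proof -
  have "cinner (P x) x = cinner x (P x)"
    by (rule cinner_eqI) (simp_all add: sym flip: lin)
  then have "Im (cinner (P x) x) = 0"
    using cinner_commute[of x "P x"] by (simp add: complex_eq_iff)
  then show ?thesis by (simp add: complex_eq_iff Re_cinner)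
qed

text \<open>
  The hypothesis \<open>\<parallel>T x\<parallel>\<^sup>2 \<le> \<langle>T x, x\<rangle>\<close> expresses \<open>0 \<le> T \<le> 1\<close> in the form that is needed: it gives
  \<open>\<parallel>x - T x\<parallel> \<le> \<parallel>x\<parallel>\<close> at once. Hence the iterates for \<open>X = 1 - T\<close> converge in operator norm to some
  \<open>Y\<close> with \<open>\<parallel>Y\<parallel> \<le> 1\<close>. Then \<open>P = 1 - Y\<close> has square \<open>T\<close>, and it is positive because
  \<open>\<langle>Y x, x\<rangle> \<le> \<parallel>x\<parallel>\<^sup>2\<close>. Symmetry and complex linearity pass from the iterates to the limit.
\<close>

lemma contraction_square_root:
  fixes T :: "'a::chilbert_space \<Rightarrow> 'a"
  assumes T: "bounded_clinear T" and sym: "\<And>x y. inner (T x) y = inner x (T y)"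
    and le: "\<And>x. (norm (T x))\<^sup>2 \<le> inner (T x) x"
  shows "\<exists>P. positive_op P \<and> P ^^ 2 = T"
proof -
  define X where "X = id_blinfun - Blinfun T"
  have X: "blinfun_apply X x = x - T x" for x
    by (simp add: X_def minus_blinfun.rep_eq
        bounded_linear_Blinfun_apply[OF bounded_clinear_imp_bounded_linear[OF T]])
  have "norm (X x) \<le> norm x" for x
  proof -
    have "(norm (X x))\<^sup>2 = (norm x)\<^sup>2 - 2 * inner (T x) x + (norm (T x))\<^sup>2"
      by (simp add: X power2_norm_eq_inner inner_diff_left inner_diff_right inner_commute)
    also have "\<dots> \<le> (norm x)\<^sup>2"
      using le[of x] zero_le_power2[of "norm (T x)"] by linarith
    finally show ?thesis by simp
  qed
  then have "norm X \<le> 1" by (intro norm_blinfun_bound) auto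
  then obtain Y where Y: "sqrt_iter X \<longlonglongrightarrow> Y"
    using convergent_sqrt_iter unfolding convergent_def by blast
  have Y_apply: "(\<lambda>n. sqrt_iter X n x) \<longlonglongrightarrow> Y x" for x
    by (rule tendsto_intros)+ (rule Y tendsto_const)+
  have "Y = (1/2) *\<^sub>R (X + (Y o\<^sub>L Y))"
  proof (rule LIMSEQ_unique)
    show "(\<lambda>n. sqrt_iter X (Suc n)) \<longlonglongrightarrow> Y" using Y by (rule LIMSEQ_Suc)
    show "(\<lambda>n. sqrt_iter X (Suc n)) \<longlonglongrightarrow> (1/2) *\<^sub>R (X + (Y o\<^sub>L Y))"
      unfolding sqrt_iter.simps
      by (intro tendsto_intros bounded_bilinear.tendsto[OF bounded_bilinear_blinfun_compose] Y)
  qed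
  then have double: "2 *\<^sub>R Y = 2 *\<^sub>R ((1/2) *\<^sub>R (X + (Y o\<^sub>L Y)))" by (rule arg_cong)
  have fixpoint: "2 *\<^sub>R Y x = x - T x + Y (Y x)" for x
    using arg_cong[OF double, of "\<lambda>Z. blinfun_apply Z x"]
    by (simp add: X plus_blinfun.rep_eq scaleR_blinfun.rep_eq)
  have "norm Y \<le> 1"
  proof (rule LIMSEQ_le_const2[OF tendsto_norm[OF Y]])
    have "norm (sqrt_iter X n) \<le> 1" for n
      using norm_sqrt_iter_le[OF \<open>norm X \<le> 1\<close>, of n] sqrt_iter_bound_range[of n] by linarith
    then show "\<exists>N. \<forall>n\<ge>N. norm (sqrt_iter X n) \<le> 1" by blast
  qed
  have Y_lin: "Y (c *\<^sub>C x) = c *\<^sub>C Y x" for c x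
  proof -
    define S where "S = Blinfun ((*\<^sub>C) c :: 'a \<Rightarrow> 'a)"
    have S: "blinfun_apply S x = c *\<^sub>C x" for x
      by (simp add: S_def bounded_linear_Blinfun_apply[OF bounded_linear_scaleC])
    have "S o\<^sub>L X = X o\<^sub>L S"
      by (rule blinfun_eqI)
         (simp add: S X bounded_clinear_scaleC[OF T]
           linear_diff[OF bounded_linear.linear[OF bounded_linear_scaleC]])
    then have "c *\<^sub>C sqrt_iter X n x = sqrt_iter X n (c *\<^sub>C x)" for n
      using sqrt_iter_commute[of S X n] by (metis S blinfun_apply_blinfun_compose)
    then have "(\<lambda>n. sqrt_iter X n (c *\<^sub>C x)) \<longlonglongrightarrow> c *\<^sub>C Y x"
      using bounded_linear.tendsto[OF bounded_linear_scaleC Y_apply[of x], of c] by simp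
    then show ?thesis using Y_apply LIMSEQ_unique by blast
  qed
  have Y_sym: "inner (Y x) y = inner x (Y y)" for x y
  proof -
    have "inner (sqrt_iter X n x) y = inner x (sqrt_iter X n y)" for n x y
      by (induction n arbitrary: x y)
         (simp_all add: X sym inner_diff_left inner_diff_right plus_blinfun.rep_eq
            scaleR_blinfun.rep_eq inner_add_left inner_add_right)
    then have "(\<lambda>n. inner (sqrt_iter X n x) y) \<longlonglongrightarrow> inner x (Y y)"
      using tendsto_inner[OF tendsto_const[of x] Y_apply[of y]] by simp
    then show ?thesis
      using tendsto_inner[OF Y_apply[of x] tendsto_const[of y]] LIMSEQ_unique by blast
  qed
  define P where "P x = x - Y x" for x
  have P_lin: "P (c *\<^sub>C x) = c *\<^sub>C P x" for c x
    by (simp add: P_def Y_lin linear_diff[OF bounded_linear.linear[OF bounded_linear_scaleC]])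
  have P_nonneg: "0 \<le> inner (P x) x" for x
  proof -
    have "inner (Y x) x \<le> norm (Y x) * norm x" by (rule norm_cauchy_schwarz)
    also have "\<dots> \<le> (norm Y * norm x) * norm x"
      by (intro mult_right_mono norm_blinfun) simp
    also have "\<dots> \<le> (1 * norm x) * norm x"
      using \<open>norm Y \<le> 1\<close> by (intro mult_right_mono) auto
    finally show ?thesis by (simp add: P_def inner_diff_left dot_square_norm power2_eq_square)
  qed
  have P_sym: "inner (P x) y = inner x (P y)" for x y
    by (simp add: P_def Y_sym inner_diff_left inner_diff_right)
  have "bounded_linear P"
    unfolding P_def by (intro bounded_linear_sub bounded_linear_ident blinfun.bounded_linear_right)
  then have "positive_op P"
    using P_nonneg P_lin
    by (simp add: positive_op_def bounded_clinear_def symmetric_imp_cinner_real[OF P_lin P_sym])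
  moreover have "P ^^ 2 = T"
  proof
    fix x
    have "(P ^^ 2) x = x - 2 *\<^sub>R Y x + Y (Y x)"
      by (simp add: P_def numeral_2_eq_2 blinfun.diff_right scaleR_2)
    also have "\<dots> = T x" by (simp add: fixpoint)
    finally show "(P ^^ 2) x = T x" .
  qed
  ultimately show ?thesis by blast
qed

text \<open>
  With \<open>\<parallel>A\<^sup>*\<parallel> \<le> K\<close>, the operator \<open>T = A\<^sup>* A / K\<^sup>2\<close> satisfies
  \<open>\<parallel>T x\<parallel>\<^sup>2 \<le> \<parallel>A x\<parallel>\<^sup>2 / K\<^sup>2 = \<langle>T x, x\<rangle>\<close>, so it has a positive square root; multiplying that
  by \<open>K\<close> shows that the choice defining \<open>|A|\<close> is made from a nonempty set.
\<close>

lemma abs_op_square: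
  fixes A :: "'a::chilbert_space \<Rightarrow> 'a"
  assumes A: "bounded_clinear A"
  shows "abs_op A ^^ 2 = cadjoint A \<circ> A"
proof -
  note A' = bounded_clinear_cadjoint[OF A]
  obtain K where K: "0 < K" "\<And>x. norm (A x) \<le> norm x * K"
    using bounded_linear.pos_bounded[OF bounded_clinear_imp_bounded_linear[OF A]] by blast
  have K': "norm (cadjoint A x) \<le> K * norm x" for x
    using norm_cadjoint_le[OF A, of K] K by (simp add: mult.commute)
  define T where "T x = inverse (K\<^sup>2) *\<^sub>R (cadjoint A \<circ> A) x" for x
  have T: "bounded_clinear T"
    unfolding T_def by (intro bounded_clinear_scaleR bounded_clinear_compose A A')
  have form: "inner (T x) y = inverse (K\<^sup>2) * inner (A x) (A y)" for x y
    by (simp add: T_def) (metis inner_cadjoint[OF A] inner_commute)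
  have "\<exists>P. positive_op P \<and> P ^^ 2 = T"
  proof (rule contraction_square_root[OF T])
    show "inner (T x) y = inner x (T y)" for x y
      using form[of x y] form[of y x] by (simp add: inner_commute)
    show "(norm (T x))\<^sup>2 \<le> inner (T x) x" for x
    proof -
      have "(norm (T x))\<^sup>2 = inverse (K\<^sup>2) ^ 2 * (norm (cadjoint A (A x)))\<^sup>2"
        by (simp add: T_def power_mult_distrib)
      also have "\<dots> \<le> inverse (K\<^sup>2) ^ 2 * (K * norm (A x))\<^sup>2"
        by (intro mult_left_mono power_mono K') auto
      also have "\<dots> = inner (T x) x"
        using K(1) by (simp add: form power_mult_distrib dot_square_norm field_simps power2_eq_square)
      finally show ?thesis .
    qed
  qed
  then obtain P where P: "positive_op P" "P ^^ 2 = T" by blast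
  define Q where "Q x = K *\<^sub>R P x" for x
  have P_clin: "bounded_clinear P" using P(1) by (simp add: positive_op_def)
  have "positive_op Q"
  proof -
    have "cinner (Q x) x = complex_of_real K * cinner (P x) x" for x
      by (simp add: Q_def cinner_scaleC_left flip: scaleC_of_real)
    then show ?thesis
      using P(1) K(1) P_clin unfolding positive_op_def Q_def
      by (auto intro!: bounded_clinear_scaleR simp: complex_nonneg_Reals_iff)
  qed
  moreover have "Q ^^ 2 = cadjoint A \<circ> A"
  proof
    fix x
    have "(Q ^^ 2) x = K\<^sup>2 *\<^sub>R (P ^^ 2) x"
      using linear_scale[OF bounded_linear.linear[OF bounded_clinear_imp_bounded_linear[OF P_clin]]]
      by (simp add: Q_def numeral_2_eq_2)
    then show "(Q ^^ 2) x = (cadjoint A \<circ> A) x"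
      using K(1) by (simp add: P(2) T_def)
  qed
  ultimately show ?thesis
    unfolding abs_op_def sqrt_op_def by (metis (mono_tags, lifting) someI_ex)
qed

section \<open>The numerical radius\<close>

lemma bdd_above_numerical_range:
  assumes "bounded_clinear T"
  shows "bdd_above (insert 0 {cmod (cinner (T x) x) | x. norm x = 1})"
proof -
  obtain K where K: "0 < K" "\<And>x. norm (T x) \<le> norm x * K"
    using bounded_linear.pos_bounded[OF bounded_clinear_imp_bounded_linear[OF assms]] by blast
  have "cmod (cinner (T x) x) \<le> K" if "norm x = 1" for x
    using cmod_cinner_le[of "T x" x] K(2)[of x] that by simp
  then show ?thesis using K(1) by (intro bdd_aboveI[where M = K]) auto
qed

lemma numerical_radius_nonneg:
  "bounded_clinear T \<Longrightarrow> 0 \<le> numerical_radius T"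
  unfolding numerical_radius_def by (rule cSup_upper[OF _ bdd_above_numerical_range]) auto

lemma cmod_cinner_le_numerical_radius:
  assumes "bounded_clinear T"
  shows "cmod (cinner (T x) x) \<le> numerical_radius T * (norm x)\<^sup>2"
proof (cases "x = 0")
  case True
  then show ?thesis using cmod_cinner_le[of "T x" x] by simp
next
  case False
  define u where "u = inverse (norm x) *\<^sub>R x"
  have u: "norm u = 1" "x = complex_of_real (norm x) *\<^sub>C u"
    using False by (simp_all add: u_def scaleC_of_real)
  have "cinner (T x) x = complex_of_real (norm x) * cinner (T u) x"
    using u(2) assms by (metis bounded_clinear_scaleC cinner_scaleC_left)
  moreover have "cmod (cinner (T u) x) = cmod (cinner x (T u))"
    using cinner_commute[of "T u" x] by simp
  moreover have "cinner x (T u) = complex_of_real (norm x) * cinner u (T u)"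
    using u(2) by (metis cinner_scaleC_left)
  moreover have "cmod (cinner u (T u)) = cmod (cinner (T u) u)"
    using cinner_commute[of u "T u"] by simp
  ultimately have "cmod (cinner (T x) x) = (norm x)\<^sup>2 * cmod (cinner (T u) u)"
    by (simp add: norm_mult power2_eq_square)
  moreover have "cmod (cinner (T u) u) \<le> numerical_radius T"
    unfolding numerical_radius_def
    by (rule cSup_upper[OF _ bdd_above_numerical_range[OF assms]]) (use u(1) in blast)
  ultimately show ?thesis by (simp add: mult.commute[of "(norm x)\<^sup>2"] mult_right_mono)
qed

lemma numerical_radius_le:
  assumes "0 \<le> c" "\<And>x. norm x = 1 \<Longrightarrow> cmod (cinner (T x) x) \<le> c"
  shows "numerical_radius T \<le> c"
  unfolding numerical_radius_def by (rule cSup_least) (use assms in auto)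

text \<open>
  Polarisation and the parallelogram law give \<open>2 \<langle>S x, y\<rangle> \<le> c (\<parallel>x\<parallel>\<^sup>2 + \<parallel>y\<parallel>\<^sup>2)\<close>. Taking for \<open>y\<close> the
  vector of length \<open>\<parallel>x\<parallel>\<close> in the direction of \<open>S x\<close> yields the norm bound.
\<close>

lemma norm_le_quadratic_form_bound:
  fixes S :: "'a::real_inner \<Rightarrow> 'a"
  assumes "linear S" and sym: "\<And>x y. inner (S x) y = inner x (S y)"
    and bound: "\<And>x. \<bar>inner (S x) x\<bar> \<le> c * (norm x)\<^sup>2" and "0 \<le> c"
  shows "norm (S x) \<le> c * norm x"
proof -
  interpret linear S by fact
  have polar: "2 * inner (S x) y \<le> c * ((norm x)\<^sup>2 + (norm y)\<^sup>2)" for x y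
  proof -
    have "4 * inner (S x) y = inner (S (x + y)) (x + y) - inner (S (x - y)) (x - y)"
      using sym[of y x]
      by (simp add: add diff inner_add_left inner_add_right inner_diff_left inner_diff_right
          inner_commute[of y "S x"])
    also have "\<dots> \<le> c * (norm (x + y))\<^sup>2 + c * (norm (x - y))\<^sup>2"
      using bound[of "x + y"] bound[of "x - y"] by linarith
    also have "\<dots> = 2 * (c * ((norm x)\<^sup>2 + (norm y)\<^sup>2))"
      by (simp add: power2_norm_eq_inner inner_add_left inner_add_right inner_diff_left
          inner_diff_right inner_commute[of y x] algebra_simps)
    finally show ?thesis by simp
  qed
  show ?thesis
  proof (cases "x = 0 \<or> S x = 0")
    case True
    then show ?thesis using \<open>0 \<le> c\<close> zero by auto
  next
    case False
    define y where "y = (norm x / norm (S x)) *\<^sub>R S x"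
    have "norm y = norm x" using False by (simp add: y_def)
    have "inner (S x) y = norm x * norm (S x)"
      using False by (simp add: y_def dot_square_norm power2_eq_square)
    then have "norm x * norm (S x) \<le> norm x * (c * norm x)"
      using polar[of x y] \<open>norm y = norm x\<close> by (simp add: power2_eq_square mult_ac)
    then show ?thesis using False by simp
  qed
qed

context
  fixes A :: "'a::chilbert_space \<Rightarrow> 'a"
  assumes A: "bounded_clinear A"
begin

text \<open>
  The quadratic form of \<open>A\<^sup>* + A\<close> is \<open>2 Re \<langle>A x, x\<rangle>\<close>.
\<close>

lemma norm_cadjoint_add_le:
  "norm (cadjoint A x + A x) \<le> 2 * numerical_radius A * norm x"
proof (rule norm_le_quadratic_form_bound)
  show "linear (\<lambda>x. cadjoint A x + A x)"
    using A by (intro bounded_linear.linear bounded_clinear_imp_bounded_linear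
        bounded_clinear_add bounded_clinear_cadjoint)
  show "inner (cadjoint A x + A x) y = inner x (cadjoint A y + A y)" for x y
    using inner_cadjoint[OF A, of x y] inner_cadjoint[OF A, of y x]
    by (simp add: inner_add_left inner_add_right inner_commute)
  show "\<bar>inner (cadjoint A x + A x) x\<bar> \<le> 2 * numerical_radius A * (norm x)\<^sup>2" for x
  proof -
    have "inner (cadjoint A x + A x) x = 2 * Re (cinner (A x) x)"
      using inner_cadjoint[OF A, of x x] inner_commute[of x "cadjoint A x"]
      by (simp add: inner_add_left Re_cinner)
    then show ?thesis
      using abs_Re_le_cmod[of "cinner (A x) x"] cmod_cinner_le_numerical_radius[OF A, of x] by simp
  qed
qed (simp add: numerical_radius_nonneg[OF A])

lemma cadjoint_diff_skew: "inner (cadjoint A x - A x) y = - inner x (cadjoint A y - A y)"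
  using inner_cadjoint[OF A, of x y] inner_cadjoint[OF A, of y x]
  by (simp add: inner_diff_left inner_diff_right inner_commute)

text \<open>
  Multiplication by \<open>\<i>\<close> preserves norms and turns the skew-adjoint \<open>A\<^sup>* - A\<close> into a self-adjoint
  operator, whose quadratic form is \<open>2 Im \<langle>A x, x\<rangle>\<close>.
\<close>

lemma norm_cadjoint_diff_le:
  "norm (cadjoint A x - A x) \<le> 2 * numerical_radius A * norm x"
proof -
  have N: "bounded_clinear (\<lambda>x. cadjoint A x - A x)"
    using A by (intro bounded_clinear_diff bounded_clinear_cadjoint)
  have "norm (\<i> *\<^sub>C (cadjoint A x - A x)) \<le> 2 * numerical_radius A * norm x"
  proof (rule norm_le_quadratic_form_bound)
    show "linear (\<lambda>x. \<i> *\<^sub>C (cadjoint A x - A x))"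
      using N by (intro bounded_linear.linear bounded_linear_compose[OF bounded_linear_scaleC]
          bounded_clinear_imp_bounded_linear)
    show "inner (\<i> *\<^sub>C (cadjoint A x - A x)) y = inner x (\<i> *\<^sub>C (cadjoint A y - A y))" for x y
      using cadjoint_diff_skew[of x "\<i> *\<^sub>C y"] bounded_clinear_scaleC[OF N, of \<i> y]
      by (simp add: inner_scaleC_left scaleC_minus_left)
    show "\<bar>inner (\<i> *\<^sub>C (cadjoint A x - A x)) x\<bar> \<le> 2 * numerical_radius A * (norm x)\<^sup>2" for x
    proof -
      have "cinner (cadjoint A x) x = cnj (cinner (A x) x)"
        using cinner_cadjoint[OF A, of x x] cinner_commute[of "cadjoint A x" x] by simp
      then have "Im (cinner (cadjoint A x - A x) x) = - 2 * Im (cinner (A x) x)"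
        by (simp add: cinner_diff_left)
      then have "inner (\<i> *\<^sub>C (cadjoint A x - A x)) x = 2 * Im (cinner (A x) x)"
        by (simp add: Im_cinner)
      then show ?thesis
        using abs_Im_le_cmod[of "cinner (A x) x"] cmod_cinner_le_numerical_radius[OF A, of x] by simp
    qed
  qed (simp add: numerical_radius_nonneg[OF A])
  then show ?thesis by (simp add: norm_scaleC)
qed

end

lemma norm_funpow2_le:
  fixes f :: "'a::real_normed_vector \<Rightarrow> 'a"
  assumes "\<And>x. norm (f x) \<le> c * norm x" "0 \<le> c"
  shows "norm ((f ^^ 2) x) \<le> c\<^sup>2 * norm x"
proof -
  have "norm (f (f x)) \<le> c * norm (f x)" by (rule assms)
  also have "\<dots> \<le> c * (c * norm x)" using assms by (intro mult_left_mono) auto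
  finally show ?thesis by (simp add: numeral_2_eq_2)
qed

theorem theorem2p2:
  fixes A :: "'a::chilbert_space \<Rightarrow> 'a"
  assumes "bounded_clinear A"
  shows "1 / 4 * onorm (\<lambda>x. (abs_op A ^^ 2) x + (abs_op (cadjoint A) ^^ 2) x)
      \<le> 1 / 2 * sqrt (2 * numerical_radius A ^ 4 + 1 / 8 * numerical_radius
          (((\<lambda>x. cadjoint A x - A x) ^^ 2) \<circ> ((\<lambda>x. cadjoint A x + A x) ^^ 2)))
    \<and> 1 / 2 * sqrt (2 * numerical_radius A ^ 4 + 1 / 8 * numerical_radius
          (((\<lambda>x. cadjoint A x - A x) ^^ 2) \<circ> ((\<lambda>x. cadjoint A x + A x) ^^ 2)))
      \<le> numerical_radius A ^ 2"
proof -
  note A = assms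
  note A' = bounded_clinear_cadjoint[OF A]
  define M where "M = (\<lambda>x. cadjoint A x + A x)"
  define N where "N = (\<lambda>x. cadjoint A x - A x)"
  define w where "w = numerical_radius A"
  define v where "v = numerical_radius ((N ^^ 2) \<circ> (M ^^ 2))"
  have M: "bounded_clinear M" unfolding M_def by (intro bounded_clinear_add A A')
  have N: "bounded_clinear N" unfolding N_def by (intro bounded_clinear_diff A A')
  have NM: "bounded_clinear ((N ^^ 2) \<circ> (M ^^ 2))"
    using M N by (simp add: numeral_2_eq_2 bounded_clinear_compose)
  have "0 \<le> w" unfolding w_def by (rule numerical_radius_nonneg[OF A])
  have "0 \<le> v" unfolding v_def by (rule numerical_radius_nonneg[OF NM])
  have M2: "norm ((M ^^ 2) x) \<le> 4 * w\<^sup>2 * norm x" for x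
    using norm_funpow2_le[of M "2 * w" x] norm_cadjoint_add_le[OF A] \<open>0 \<le> w\<close>
    by (simp add: M_def w_def power_mult_distrib)
  have N2: "norm ((N ^^ 2) x) \<le> 4 * w\<^sup>2 * norm x" for x
    using norm_funpow2_le[of N "2 * w" x] norm_cadjoint_diff_le[OF A] \<open>0 \<le> w\<close>
    by (simp add: N_def w_def power_mult_distrib)
  have N2_sym: "inner ((N ^^ 2) x) y = inner x ((N ^^ 2) y)" for x y
    using cadjoint_diff_skew[OF A] by (simp add: N_def numeral_2_eq_2)

  define P where "P x = (abs_op A ^^ 2) x + (abs_op (cadjoint A) ^^ 2) x" for x
  have P: "2 *\<^sub>R P x = (M ^^ 2) x - (N ^^ 2) x" for x
  proof -
    note add = linear_add[OF bounded_linear.linear[OF bounded_clinear_imp_bounded_linear]]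
    note diff = linear_diff[OF bounded_linear.linear[OF bounded_clinear_imp_bounded_linear]]
    have "P x = cadjoint A (A x) + A (cadjoint A x)"
      by (simp only: P_def abs_op_square[OF A] abs_op_square[OF A'] cadjoint_cadjoint[OF A] comp_apply)
    then show ?thesis
      by (simp add: M_def N_def numeral_2_eq_2 add[OF A] add[OF A'] diff[OF A] diff[OF A'] scaleR_2)
  qed
  have "norm (P x) \<le> 2 * sqrt (2 * w ^ 4 + 1 / 8 * v) * norm x" for x
  proof -
    have cross: "\<bar>inner ((M ^^ 2) x) ((N ^^ 2) x)\<bar> \<le> v * (norm x)\<^sup>2"
    proof -
      have eq: "inner ((M ^^ 2) x) ((N ^^ 2) x) = Re (cinner (((N ^^ 2) \<circ> (M ^^ 2)) x) x)"
        by (simp add: Re_cinner N2_sym)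
      show ?thesis
        unfolding eq v_def
        by (rule order_trans[OF abs_Re_le_cmod cmod_cinner_le_numerical_radius[OF NM]])
    qed
    have sq: "(4 * w\<^sup>2 * norm x)\<^sup>2 = 16 * w ^ 4 * (norm x)\<^sup>2"
      by (simp add: power_mult_distrib flip: power_mult)
    have "4 * (norm (P x))\<^sup>2 = (norm (2 *\<^sub>R P x))\<^sup>2" by (simp add: power_mult_distrib)
    also have "\<dots> = (norm ((M ^^ 2) x))\<^sup>2 + (norm ((N ^^ 2) x))\<^sup>2
        - 2 * inner ((M ^^ 2) x) ((N ^^ 2) x)"
      by (simp add: P power2_norm_eq_inner inner_diff_left inner_diff_right inner_commute)
    also have "\<dots> \<le> 16 * w ^ 4 * (norm x)\<^sup>2 + 16 * w ^ 4 * (norm x)\<^sup>2 + 2 * (v * (norm x)\<^sup>2)"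
      using power_mono[OF M2[of x], of 2] power_mono[OF N2[of x], of 2] cross
      unfolding sq by simp
    also have "\<dots> = 4 * (4 * (2 * w ^ 4 + 1 / 8 * v) * (norm x)\<^sup>2)" by (simp add: algebra_simps)
    also have "\<dots> = 4 * (2 * sqrt (2 * w ^ 4 + 1 / 8 * v) * norm x)\<^sup>2"
      using \<open>0 \<le> w\<close> \<open>0 \<le> v\<close> by (simp add: power_mult_distrib)
    finally have "(norm (P x))\<^sup>2 \<le> (2 * sqrt (2 * w ^ 4 + 1 / 8 * v) * norm x)\<^sup>2" by simp
    then show ?thesis
      by (rule power2_le_imp_le) (use \<open>0 \<le> w\<close> \<open>0 \<le> v\<close> in simp)
  qed
  then have "onorm P \<le> 2 * sqrt (2 * w ^ 4 + 1 / 8 * v)"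
    using \<open>0 \<le> w\<close> \<open>0 \<le> v\<close> by (intro onorm_bound) auto
  then have first: "1 / 4 * onorm P \<le> 1 / 2 * sqrt (2 * w ^ 4 + 1 / 8 * v)" by simp

  have "v \<le> 16 * w ^ 4"
    unfolding v_def
  proof (rule numerical_radius_le)
    fix x :: 'a assume "norm x = 1"
    have "cmod (cinner (((N ^^ 2) \<circ> (M ^^ 2)) x) x) \<le> norm ((N ^^ 2) ((M ^^ 2) x))"
      using cmod_cinner_le[of "((N ^^ 2) \<circ> (M ^^ 2)) x" x] \<open>norm x = 1\<close> by simp
    also have "\<dots> \<le> 4 * w\<^sup>2 * norm ((M ^^ 2) x)" by (rule N2)
    also have "\<dots> \<le> 4 * w\<^sup>2 * (4 * w\<^sup>2)"
      using M2[of x] \<open>norm x = 1\<close> by (intro mult_left_mono) auto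
    also have "\<dots> = 16 * w ^ 4" by (simp flip: power_add)
    finally show "cmod (cinner (((N ^^ 2) \<circ> (M ^^ 2)) x) x) \<le> 16 * w ^ 4" .
  qed simp
  then have "2 * w ^ 4 + 1 / 8 * v \<le> (2 * w\<^sup>2)\<^sup>2"
    by (simp add: power_mult_distrib flip: power_mult)
  then have "sqrt (2 * w ^ 4 + 1 / 8 * v) \<le> 2 * w\<^sup>2"
    by (intro real_le_lsqrt) simp_all
  then have second: "1 / 2 * sqrt (2 * w ^ 4 + 1 / 8 * v) \<le> w ^ 2" by simp
  show ?thesis
    using first second unfolding P_def w_def v_def M_def N_def by blast
qed

end
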